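(* Let $G=G_1\ast\dots\ast G_n$ be a group which splits as a free product of $n\ge 3$ non-trivial factors, and let $\mathfrak{S}=(G_1,\dots,G_n)$. Then any pure symmetric outer automorphism $\Psi\in\mathrm{Out}_{\mathfrak{S}}(G)$ of the splitting $G_1\ast\dots\ast G_n$ can be written as a product of factor outer automorphisms relative to $\mathfrak{S}$ and Whitehead outer automorphisms relative to $\mathfrak{S}$.
   Context: For a subgroup $H\le G$ and $g\in G$ write $H^g=g^{-1}Hg$. $\mathrm{Out}(G)=\mathrm{Aut}(G)/\mathrm{Inn}(G)$. An automorphism $\psi\in\mathrm{Aut}(G)$ is a pure symmetric automorphism of the splitting if for each $i$ there is $g_i\in G$ with $\psi(G_i)=G_i^{g_i}$; these form the subgroup $\mathrm{Aut}_{\mathfrak{S}}(G)\le\mathrm{Aut}(G)$. An element $\Psi\in\mathrm{Out}(G)$ is a pure symmetric outer automorphism of the splitting if some representative $\psi\in\Psi$ is a pure symmetric automorphism; these form the subgroup $\mathrm{Out}_{\mathfrak{S}}(G)\le\mathrm{Out}(G)$. A factor automorphism relative to $\mathfrak{S}$ is $\varphi\in\mathrm{Aut}_{\mathfrak{S}}(G)$ such that $\varphi|_{G_i}\in\mathrm{Aut}(G_i)$ for every $i$. A factor outer automorphism relative to $\mathfrak{S}$ is an element of $\mathrm{Out}_{\mathfrak{S}}(G)$ having a representative that is a factor automorphism. Given $i\in\{1,\dots,n\}$, $x\in G_i$ and $Y\subseteq\{G_1,\dots,G_n\}\setminus\{G_i\}$, the Whitehead automorphism $(Y,x)$ relative to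 $\mathfrak{S}$ (with operating factor $G_i$) is the automorphism of $G$ which, for each $j$ and each $g\in G_j$, maps $g\mapsto x^{-1}gx$ if $G_j\in Y$ and $g\mapsto g$ if $G_j\notin Y$. A Whitehead outer automorphism relative to $\mathfrak{S}$ is an element of $\mathrm{Out}_{\mathfrak{S}}(G)$ having a representative that is a Whitehead automorphism relative to $\mathfrak{S}$. *)

theory Defs
  imports "HOL-Algebra.Algebra"
begin

section \<open>Internal free products\<close>

text \<open>
  A word over the factors \<open>H 1, \<dots>, H n\<close> is a list of syllables \<open>(i, g)\<close> with \<open>g \<in> H i\<close>; it is
  reduced if no syllable is trivial and consecutive syllables come from different factors.
\<close>

definition reduced_words :: "('a, 'b) monoid_scheme \<Rightarrow> nat \<Rightarrow> (nat \<Rightarrow> 'a set) \<Rightarrow> (nat \<times> 'a) list set"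
  where "reduced_words G n H =
    {w. (\<forall>(i, g) \<in> set w. i \<in> {1..n} \<and> g \<in> H i \<and> g \<noteq> \<one>\<^bsub>G\<^esub>) \<and> distinct_adj (map fst w)}"

definition list_prod :: "('a, 'b) monoid_scheme \<Rightarrow> 'a list \<Rightarrow> 'a"
  where "list_prod G xs = foldr (\<lambda>x y. x \<otimes>\<^bsub>G\<^esub> y) xs \<one>\<^bsub>G\<^esub>"

text \<open>
  The abstract free product of the \<open>H i\<close> has the reduced words as its elements, and evaluation
  of words is its canonical homomorphism to \<open>G\<close>. So \<open>G\<close> is the (internal) free product of its
  subgroups \<open>H 1, \<dots>, H n\<close> iff evaluation of reduced words is a bijection onto \<open>G\<close>, i.e. every
  element of \<open>G\<close> has exactly one reduced form.
\<close>

definition is_free_product :: "('a, 'b) monoid_scheme \<Rightarrow> nat \<Rightarrow> (nat \<Rightarrow> 'a set) \<Rightarrow> bool"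
  where "is_free_product G n H \<longleftrightarrow>
    group G \<and> (\<forall>i\<in>{1..n}. subgroup (H i) G) \<and>
    bij_betw (\<lambda>w. list_prod G (map snd w)) (reduced_words G n H) (carrier G)"


section \<open>Outer automorphisms\<close>

definition Inn :: "('a, 'b) monoid_scheme \<Rightarrow> ('a \<Rightarrow> 'a) set"
  where "Inn G = {\<lambda>x\<in>carrier G. inv\<^bsub>G\<^esub> g \<otimes>\<^bsub>G\<^esub> x \<otimes>\<^bsub>G\<^esub> g | g. g \<in> carrier G}"

definition Out :: "('a, 'b) monoid_scheme \<Rightarrow> ('a \<Rightarrow> 'a) set monoid"
  where "Out G = AutoGroup G Mod Inn G"


section \<open>Automorphisms relative to a splitting\<close>

definition conj_set :: "('a, 'b) monoid_scheme \<Rightarrow> 'a set \<Rightarrow> 'a \<Rightarrow> 'a set"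
  where "conj_set G K g = inv\<^bsub>G\<^esub> g <#\<^bsub>G\<^esub> K #>\<^bsub>G\<^esub> g"

definition pure_symmetric_auts ::
    "('a, 'b) monoid_scheme \<Rightarrow> nat \<Rightarrow> (nat \<Rightarrow> 'a set) \<Rightarrow> ('a \<Rightarrow> 'a) set"
  where "pure_symmetric_auts G n H =
    {\<psi> \<in> auto G. \<forall>i\<in>{1..n}. \<exists>g\<in>carrier G. \<psi> ` H i = conj_set G (H i) g}"

definition pure_symmetric_outs ::
    "('a, 'b) monoid_scheme \<Rightarrow> nat \<Rightarrow> (nat \<Rightarrow> 'a set) \<Rightarrow> ('a \<Rightarrow> 'a) set set"
  where "pure_symmetric_outs G n H =
    {\<Psi> \<in> carrier (Out G). \<exists>\<psi>\<in>\<Psi>. \<psi> \<in> pure_symmetric_auts G n H}"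

definition factor_auts ::
    "('a, 'b) monoid_scheme \<Rightarrow> nat \<Rightarrow> (nat \<Rightarrow> 'a set) \<Rightarrow> ('a \<Rightarrow> 'a) set"
  where "factor_auts G n H =
    {\<phi> \<in> pure_symmetric_auts G n H. \<forall>i\<in>{1..n}. restrict \<phi> (H i) \<in> auto (G\<lparr>carrier := H i\<rparr>)}"

definition factor_outs ::
    "('a, 'b) monoid_scheme \<Rightarrow> nat \<Rightarrow> (nat \<Rightarrow> 'a set) \<Rightarrow> ('a \<Rightarrow> 'a) set set"
  where "factor_outs G n H =
    {\<Phi> \<in> pure_symmetric_outs G n H. \<exists>\<phi>\<in>\<Phi>. \<phi> \<in> factor_auts G n H}"

text \<open>
  The conditions on the factors determine the Whitehead automorphism \<open>(Y, x)\<close> uniquely, since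
  the factors generate \<open>G\<close>; it is therefore described by a predicate.
\<close>

definition is_whitehead_aut ::
    "('a, 'b) monoid_scheme \<Rightarrow> nat \<Rightarrow> (nat \<Rightarrow> 'a set) \<Rightarrow> nat \<Rightarrow> 'a set set \<Rightarrow> 'a \<Rightarrow> ('a \<Rightarrow> 'a) \<Rightarrow> bool"
  where "is_whitehead_aut G n H i Y x \<psi> \<longleftrightarrow>
    i \<in> {1..n} \<and> x \<in> H i \<and> Y \<subseteq> H ` {1..n} - {H i} \<and> \<psi> \<in> auto G \<and>
    (\<forall>j\<in>{1..n}. \<forall>g\<in>H j. \<psi> g = (if H j \<in> Y then inv\<^bsub>G\<^esub> x \<otimes>\<^bsub>G\<^esub> g \<otimes>\<^bsub>G\<^esub> x else g))"

definition whitehead_outs ::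
    "('a, 'b) monoid_scheme \<Rightarrow> nat \<Rightarrow> (nat \<Rightarrow> 'a set) \<Rightarrow> ('a \<Rightarrow> 'a) set set"
  where "whitehead_outs G n H =
    {\<Omega> \<in> pure_symmetric_outs G n H. \<exists>\<omega>\<in>\<Omega>. \<exists>i Y x. is_whitehead_aut G n H i Y x \<omega>}"

end

theory Submission
  imports Defs
begin

text \<open>
  The proof is a length reduction. A pure symmetric automorphism \<open>\<psi>\<close> sends each factor
  \<open>H i\<close> to a conjugate \<open>g\<^sub>i\<^sup>-\<^sup>1 (H i) g\<^sub>i\<close>; represent \<open>g\<^sub>i\<close> by a reduced word \<open>w i\<close> and measure
  \<open>\<psi>\<close> by the total length of these words. Two moves lower the measure. If \<open>w i\<close> starts with
  a syllable from \<open>H i\<close>, that syllable normalises \<open>H i\<close> and can be dropped. If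
  \<open>w j = u y (w i)\<close> with \<open>i \<noteq> j\<close> and \<open>y\<close> a syllable from \<open>H i\<close>, then composing \<open>\<psi>\<close> with the
  Whitehead automorphism \<open>({H j}, x)\<close>, where \<open>x \<in> H i\<close> is chosen with
  \<open>\<psi> x = g\<^sub>i\<^sup>-\<^sup>1 y\<^sup>-\<^sup>1 g\<^sub>i\<close>, replaces \<open>g\<^sub>j\<close> by \<open>g\<^sub>j (\<psi> x)\<close>, whose word \<open>u (w i)\<close> is shorter.

  When neither move applies, the conjugated factors \<open>g\<^sub>i\<^sup>-\<^sup>1 (H i) g\<^sub>i\<close> behave like a
  Nielsen-reduced system: in a product \<open>\<Prod> g\<^sub>i\<^sup>-\<^sup>1 h g\<^sub>i\<close> over a reduced word, cancellation
  happens only between neighbouring \<open>g\<^sub>i g\<^sub>j\<^sup>-\<^sup>1\<close> and never reaches the syllables \<open>h\<close>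
  (lemmas \<open>reduced_quotient\<close> and \<open>reduced_form_of_conjugates\<close>). So the reduced form
  of such a product begins with \<open>g\<^sub>i\<^sup>-\<^sup>1 h\<close>, for the first syllable \<open>h \<in> H i\<close>. As \<open>\<psi>\<close> is
  surjective, every single syllable \<open>h \<in> H i\<close> is such a product, and uniqueness of reduced
  forms leaves no room for a nontrivial \<open>g\<^sub>i\<close>. Hence all \<open>g\<^sub>i\<close> are trivial and \<open>\<psi>\<close> preserves
  every factor.

  So already in \<open>Aut(G)\<close> the automorphism \<open>\<psi>\<close> is a product of factor and Whitehead
  automorphisms (theorem \<open>pure_symmetric_aut_decomposition\<close>). The homomorphism \<open>Aut(G) \<rightarrow> Out(G)\<close> carries this product to
  outer classes. The existence of Whitehead automorphisms comes from the universal property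
  of the free product (theorem \<open>extend_hom\<close>).
\<close>

section \<open>Products of lists and conjugates\<close>

lemma list_prod_Nil [simp]: "list_prod G [] = \<one>\<^bsub>G\<^esub>"
  and list_prod_Cons [simp]: "list_prod G (x # xs) = x \<otimes>\<^bsub>G\<^esub> list_prod G xs"
  by (simp_all add: list_prod_def)

context group
begin

lemma list_prod_closed [simp]: "set xs \<subseteq> carrier G \<Longrightarrow> list_prod G xs \<in> carrier G"
  by (induction xs) auto

lemma list_prod_append:
  "set xs \<subseteq> carrier G \<Longrightarrow> set ys \<subseteq> carrier G \<Longrightarrow>
    list_prod G (xs @ ys) = list_prod G xs \<otimes> list_prod G ys"
  by (induction xs) (auto simp: m_assoc)

lemma hom_list_prod:
  assumes "group K" "h \<in> hom G K" "set xs \<subseteq> carrier G"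
  shows "h (list_prod G xs) = list_prod K (map h xs)"
proof -
  interpret group_hom G K h
    using assms by (simp add: group_hom_def group_hom_axioms_def group_axioms)
  show ?thesis using assms(3) by (induction xs) auto
qed

lemma mult_inv_cancel:
  assumes "x \<in> carrier G" "y \<in> carrier G"
  shows "x \<otimes> (inv x \<otimes> y) = y" "inv x \<otimes> (x \<otimes> y) = y"
  using assms by (simp_all flip: m_assoc)

lemma conj_set_eq_image:
  assumes "K \<subseteq> carrier G" "g \<in> carrier G"
  shows "conj_set G K g = (\<lambda>k. inv g \<otimes> k \<otimes> g) ` K"
  unfolding conj_set_def l_coset_def r_coset_def by auto

lemma conj_set_one: "K \<subseteq> carrier G \<Longrightarrow> conj_set G K \<one> = K"
  by (force simp: conj_set_eq_image)

lemma conj_set_conj_set: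
  assumes "K \<subseteq> carrier G" "g \<in> carrier G" "h \<in> carrier G"
  shows "conj_set G (conj_set G K g) h = conj_set G K (g \<otimes> h)"
proof -
  have "conj_set G K g \<subseteq> carrier G" using assms by (auto simp: conj_set_eq_image)
  then have "conj_set G (conj_set G K g) h = (\<lambda>k. inv h \<otimes> (inv g \<otimes> k \<otimes> g) \<otimes> h) ` K"
    using assms by (simp add: conj_set_eq_image image_image)
  also have "\<dots> = (\<lambda>k. inv (g \<otimes> h) \<otimes> k \<otimes> (g \<otimes> h)) ` K"
  proof (rule image_cong)
    fix k assume "k \<in> K"
    then have "k \<in> carrier G" using assms by auto
    then show "inv h \<otimes> (inv g \<otimes> k \<otimes> g) \<otimes> h = inv (g \<otimes> h) \<otimes> k \<otimes> (g \<otimes> h)"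
      using assms by (simp add: inv_mult_group m_assoc)
  qed simp
  finally show ?thesis using assms by (simp add: conj_set_eq_image)
qed

lemma conj_set_self:
  assumes "subgroup K G" "y \<in> K"
  shows "conj_set G K y = K"
proof -
  interpret K: subgroup K G by fact
  have "K #> y = K" using assms by (simp add: coset_join2 K.mem_carrier)
  moreover have "inv y <# K = K" using assms
    by (metis K.m_inv_closed K.mem_carrier coset_join3)
  ultimately show ?thesis unfolding conj_set_def by simp
qed

lemma hom_image_conj_set:
  assumes "\<psi> \<in> hom G G" "K \<subseteq> carrier G" "g \<in> carrier G"
  shows "\<psi> ` conj_set G K g = conj_set G (\<psi> ` K) (\<psi> g)"
proof -
  interpret group_hom G G \<psi>
    using assms by (simp add: group_hom_def group_hom_axioms_def group_axioms)
  have "\<psi> ` K \<subseteq> carrier G" using assms by auto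
  moreover have "\<psi> (inv g \<otimes> k \<otimes> g) = inv (\<psi> g) \<otimes> \<psi> k \<otimes> \<psi> g" if "k \<in> K" for k
    using assms that by (simp add: subset_iff)
  ultimately show ?thesis
    using assms by (simp add: conj_set_eq_image image_image cong: image_cong)
qed

section \<open>Automorphisms modulo inner automorphisms\<close>

lemma AutoGroup_carrier: "carrier (AutoGroup G) = auto G"
  by (simp add: AutoGroup_def)

lemma AutoGroup_mult:
  "f \<in> auto G \<Longrightarrow> g \<in> auto G \<Longrightarrow> f \<otimes>\<^bsub>AutoGroup G\<^esub> g = compose (carrier G) f g"
  by (simp add: AutoGroup_def BijGroup_def auto_def)

lemma AutoGroup_one: "\<one>\<^bsub>AutoGroup G\<^esub> = (\<lambda>x\<in>carrier G. x)"
  by (simp add: AutoGroup_def BijGroup_def)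

text \<open>
  Elements of \<^const>\<open>auto\<close> must be \<^const>\<open>undefined\<close> outside the carrier, hence the
  restriction.
\<close>

lemma autoI:
  assumes "\<phi> \<in> hom G G" "\<phi>' \<in> hom G G"
    and "\<And>g. g \<in> carrier G \<Longrightarrow> \<phi>' (\<phi> g) = g" "\<And>g. g \<in> carrier G \<Longrightarrow> \<phi> (\<phi>' g) = g"
  shows "restrict \<phi> (carrier G) \<in> auto G"
proof -
  have "bij_betw \<phi> (carrier G) (carrier G)"
    using assms by (intro bij_betw_byWitness[where f' = \<phi>']) (auto simp: hom_def)
  then have "bij_betw (restrict \<phi> (carrier G)) (carrier G) (carrier G)"
    by (metis bij_betw_restrict_eq)
  with assms(1) show ?thesis
    unfolding auto_def Bij_def by (auto simp: hom_def)
qed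

lemma autoD:
  assumes "\<psi> \<in> auto G"
  shows "\<psi> \<in> hom G G" "inj_on \<psi> (carrier G)" "\<psi> ` carrier G = carrier G"
    "\<psi> \<in> extensional (carrier G)"
  using assms by (auto simp: auto_def Bij_def bij_betw_def)

definition conj_aut :: "'a \<Rightarrow> 'a \<Rightarrow> 'a"
  where "conj_aut g = (\<lambda>x\<in>carrier G. inv g \<otimes> x \<otimes> g)"

lemma conj_aut_hom: "g \<in> carrier G \<Longrightarrow> (\<lambda>x. inv g \<otimes> x \<otimes> g) \<in> hom G G"
  by (auto simp: hom_def m_assoc mult_inv_cancel)

lemma conj_aut_in_auto: "g \<in> carrier G \<Longrightarrow> conj_aut g \<in> auto G"
  unfolding conj_aut_def
  by (rule autoI[OF conj_aut_hom conj_aut_hom[of "inv g"]]) (auto simp: m_assoc mult_inv_cancel)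

text \<open>The reversal of the factors comes from letting conjugation act as \<open>x \<mapsto> g\<^sup>-\<^sup>1 x g\<close>.\<close>

lemma conj_aut_mult:
  assumes "g \<in> carrier G" "h \<in> carrier G"
  shows "conj_aut g \<otimes>\<^bsub>AutoGroup G\<^esub> conj_aut h = conj_aut (h \<otimes> g)"
proof -
  have "compose (carrier G) (conj_aut g) (conj_aut h) = conj_aut (h \<otimes> g)"
    using assms by (auto simp: conj_aut_def compose_def fun_eq_iff inv_mult_group m_assoc)
  then show ?thesis using assms by (simp add: AutoGroup_mult conj_aut_in_auto)
qed

lemma Inn_eq: "Inn G = conj_aut ` carrier G"
  by (auto simp: Inn_def conj_aut_def)

lemma Inn_normal: "Inn G \<lhd> AutoGroup G"
proof -
  interpret A: group "AutoGroup G" by (rule AutoGroup)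
  have one: "conj_aut \<one> = \<one>\<^bsub>AutoGroup G\<^esub>"
    by (auto simp: conj_aut_def AutoGroup_one fun_eq_iff)
  have inv: "inv\<^bsub>AutoGroup G\<^esub> (conj_aut g) = conj_aut (inv g)" if "g \<in> carrier G" for g
    using that by (intro A.inv_equality) (auto simp: conj_aut_mult one AutoGroup_carrier conj_aut_in_auto)
  have "subgroup (Inn G) (AutoGroup G)"
    by (rule A.subgroupI) (auto simp: Inn_eq AutoGroup_carrier conj_aut_in_auto inv conj_aut_mult)
  then show ?thesis
  proof (rule A.normal_invI)
    fix \<alpha> h
    assume \<alpha>: "\<alpha> \<in> carrier (AutoGroup G)" and "h \<in> Inn G"
    then obtain g where g: "g \<in> carrier G" "h = conj_aut g" by (auto simp: Inn_eq)
    have \<alpha>': "\<alpha> \<in> auto G" using \<alpha> by (simp add: AutoGroup_carrier)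
    interpret \<alpha>: group_hom G G \<alpha>
      using autoD[OF \<alpha>'] by (simp add: group_hom_def group_hom_axioms_def group_axioms)
    have "compose (carrier G) \<alpha> h = compose (carrier G) (conj_aut (\<alpha> g)) \<alpha>"
      using g by (auto simp: conj_aut_def compose_def fun_eq_iff)
    then have "\<alpha> \<otimes>\<^bsub>AutoGroup G\<^esub> h = conj_aut (\<alpha> g) \<otimes>\<^bsub>AutoGroup G\<^esub> \<alpha>"
      using \<alpha>' g by (simp add: AutoGroup_mult conj_aut_in_auto)
    then have "\<alpha> \<otimes>\<^bsub>AutoGroup G\<^esub> h \<otimes>\<^bsub>AutoGroup G\<^esub> inv\<^bsub>AutoGroup G\<^esub> \<alpha> = conj_aut (\<alpha> g)"
      using \<alpha> g A.m_assoc[of "conj_aut (\<alpha> g)" \<alpha> "inv\<^bsub>AutoGroup G\<^esub> \<alpha>"] A.r_inv[OF \<alpha>]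
        A.inv_closed[OF \<alpha>]
      by (simp add: AutoGroup_carrier conj_aut_in_auto)
    then show "\<alpha> \<otimes>\<^bsub>AutoGroup G\<^esub> h \<otimes>\<^bsub>AutoGroup G\<^esub> inv\<^bsub>AutoGroup G\<^esub> \<alpha> \<in> Inn G"
      using g by (auto simp: Inn_eq)
  qed
qed

lemma outer_class_list_prod:
  assumes "set \<alpha>s \<subseteq> auto G"
  shows "Inn G #>\<^bsub>AutoGroup G\<^esub> list_prod (AutoGroup G) \<alpha>s =
    list_prod (Out G) (map (\<lambda>\<alpha>. Inn G #>\<^bsub>AutoGroup G\<^esub> \<alpha>) \<alpha>s)"
proof -
  interpret A: group "AutoGroup G" by (rule AutoGroup)
  interpret N: normal "Inn G" "AutoGroup G" by (rule Inn_normal)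
  show ?thesis
    unfolding Out_def using assms N.r_coset_hom_Mod N.factorgroup_is_group
    by (subst A.hom_list_prod) (auto simp: AutoGroup_carrier)
qed

text \<open>
  A pure symmetric outer automorphism only promises some pure symmetric representative; since
  cosets are equal as soon as they meet, that representative determines the class.
\<close>

lemma outer_class_rep:
  assumes "\<Psi> \<in> carrier (Out G)" "\<psi> \<in> \<Psi>"
  shows "\<psi> \<in> auto G" "\<Psi> = Inn G #>\<^bsub>AutoGroup G\<^esub> \<psi>"
proof -
  interpret A: group "AutoGroup G" by (rule AutoGroup)
  interpret N: normal "Inn G" "AutoGroup G" by (rule Inn_normal)
  obtain \<alpha> where \<alpha>: "\<alpha> \<in> carrier (AutoGroup G)" "\<Psi> = Inn G #>\<^bsub>AutoGroup G\<^esub> \<alpha>"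
    using assms(1) by (auto simp: Out_def FactGroup_def RCOSETS_def)
  have "\<psi> \<in> carrier (AutoGroup G)"
    using assms \<alpha> A.r_coset_subset_G N.subset by blast
  then show "\<psi> \<in> auto G" by (simp add: AutoGroup_carrier)
  show "\<Psi> = Inn G #>\<^bsub>AutoGroup G\<^esub> \<psi>"
    using assms \<alpha> A.repr_independence N.subgroup_axioms by metis
qed

lemma outer_class_mem:
  assumes "\<psi> \<in> auto G"
  shows "Inn G #>\<^bsub>AutoGroup G\<^esub> \<psi> \<in> carrier (Out G)" "\<psi> \<in> Inn G #>\<^bsub>AutoGroup G\<^esub> \<psi>"
proof -
  interpret A: group "AutoGroup G" by (rule AutoGroup)
  interpret N: normal "Inn G" "AutoGroup G" by (rule Inn_normal)
  show "Inn G #>\<^bsub>AutoGroup G\<^esub> \<psi> \<in> carrier (Out G)"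
    using assms by (auto simp: Out_def FactGroup_def RCOSETS_def AutoGroup_carrier)
  show "\<psi> \<in> Inn G #>\<^bsub>AutoGroup G\<^esub> \<psi>"
    using assms A.rcos_self N.subgroup_axioms by (simp add: AutoGroup_carrier)
qed

end

section \<open>Words and the universal property of a free product\<close>

locale free_product = group G for G :: "('a, 'b) monoid_scheme" (structure) +
  fixes n :: nat and H :: "nat \<Rightarrow> 'a set"
  assumes free_product: "is_free_product G n H"
begin

definition words :: "(nat \<times> 'a) list set"
  where "words = {w. \<forall>(i, g) \<in> set w. i \<in> {1..n} \<and> g \<in> H i}"

definition ev :: "(nat \<times> 'a) list \<Rightarrow> 'a"
  where "ev w = list_prod G (map snd w)"

definition winv :: "(nat \<times> 'a) list \<Rightarrow> (nat \<times> 'a) list"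
  where "winv w = rev (map (\<lambda>(i, g). (i, inv g)) w)"

abbreviation RW where "RW \<equiv> reduced_words G n H"

lemma subgroup_factor: "i \<in> {1..n} \<Longrightarrow> subgroup (H i) G"
  using free_product by (auto simp: is_free_product_def)

lemma factor_closed [simp]:
  assumes "i \<in> {1..n}"
  shows "x \<in> H i \<Longrightarrow> x \<in> carrier G" "x \<in> H i \<Longrightarrow> inv x \<in> H i" "\<one> \<in> H i"
    "x \<in> H i \<Longrightarrow> y \<in> H i \<Longrightarrow> x \<otimes> y \<in> H i"
  using subgroup_factor[OF assms]
  by (auto simp: subgroup.mem_carrier subgroup.m_inv_closed subgroup.one_closed subgroup.m_closed)

lemma factor_subset: "i \<in> {1..n} \<Longrightarrow> H i \<subseteq> carrier G"
  by auto

lemma words_Nil [simp]: "[] \<in> words"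
  and words_Cons [simp]: "(i, g) # w \<in> words \<longleftrightarrow> i \<in> {1..n} \<and> g \<in> H i \<and> w \<in> words"
  and words_append [simp]: "v @ w \<in> words \<longleftrightarrow> v \<in> words \<and> w \<in> words"
  by (auto simp: words_def)

lemma reduced_words_Nil [simp]: "[] \<in> RW"
  by (simp add: reduced_words_def)

lemma reduced_words_Cons:
  "(i, g) # w \<in> RW \<longleftrightarrow>
    i \<in> {1..n} \<and> g \<in> H i \<and> g \<noteq> \<one> \<and> w \<in> RW \<and> (w = [] \<or> fst (hd w) \<noteq> i)"
  by (auto simp: reduced_words_def distinct_adj_Cons hd_map)

lemma reduced_words_append:
  "v @ w \<in> RW \<longleftrightarrow> v \<in> RW \<and> w \<in> RW \<and> (v = [] \<or> w = [] \<or> fst (last v) \<noteq> fst (hd w))"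
  by (auto simp: reduced_words_def distinct_adj_append_iff hd_map last_map)

lemma reduced_imp_word: "w \<in> RW \<Longrightarrow> w \<in> words"
  by (auto simp: reduced_words_def words_def)

lemma ev_Nil [simp]: "ev [] = \<one>"
  and ev_Cons [simp]: "ev ((i, g) # w) = g \<otimes> ev w"
  by (simp_all add: ev_def)

lemma set_snd_word: "w \<in> words \<Longrightarrow> set (map snd w) \<subseteq> carrier G"
  by (fastforce simp: words_def)

lemma ev_closed [simp]: "w \<in> words \<Longrightarrow> ev w \<in> carrier G"
  unfolding ev_def by (rule list_prod_closed[OF set_snd_word])

lemma ev_append [simp]: "v \<in> words \<Longrightarrow> w \<in> words \<Longrightarrow> ev (v @ w) = ev v \<otimes> ev w"
  unfolding ev_def map_append by (intro list_prod_append set_snd_word)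

lemma ev_inj: "v \<in> RW \<Longrightarrow> w \<in> RW \<Longrightarrow> ev v = ev w \<Longrightarrow> v = w"
  using free_product by (auto simp: is_free_product_def bij_betw_def inj_on_def ev_def)

lemma ev_surj: "g \<in> carrier G \<Longrightarrow> \<exists>w\<in>RW. ev w = g"
  using free_product by (force simp: is_free_product_def bij_betw_def ev_def)

lemma winv_Nil [simp]: "winv [] = []"
  and winv_eq_Nil [simp]: "winv w = [] \<longleftrightarrow> w = []"
  by (simp_all add: winv_def)

lemma winv_snoc [simp]: "winv (w @ [(i, g)]) = (i, inv g) # winv w"
  by (simp add: winv_def)

lemma winv_Cons: "winv ((i, g) # w) = winv w @ [(i, inv g)]"
  by (simp add: winv_def)

lemma last_winv: "w \<noteq> [] \<Longrightarrow> fst (last (winv w)) = fst (hd w)"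
  by (cases w) (auto simp: winv_def)

lemma hd_winv: "w \<noteq> [] \<Longrightarrow> fst (hd (winv w)) = fst (last w)"
  by (cases w rule: rev_cases) (auto simp: winv_def)

lemma winv_word [simp]: "w \<in> words \<Longrightarrow> winv w \<in> words"
  by (induction w) (auto simp: winv_Cons)

lemma winv_reduced: "w \<in> RW \<Longrightarrow> winv w \<in> RW"
proof (induction w)
  case (Cons s w)
  then show ?case
    by (cases s) (auto simp: winv_Cons reduced_words_append reduced_words_Cons last_winv)
qed simp

lemma ev_winv [simp]: "w \<in> words \<Longrightarrow> ev (winv w) = inv (ev w)"
proof (induction w)
  case (Cons s w)
  then show ?case
    by (cases s) (auto simp: winv_Cons inv_mult_group)
qed simp

text \<open>
  Deleting trivial syllables and merging neighbours from one factor never lengthens a word and,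
  because each \<open>f i\<close> is a homomorphism, changes neither its value in \<open>G\<close> nor that of its
  image in \<open>K\<close>. The value in \<open>K\<close> makes the extension of the \<open>f i\<close> to \<open>G\<close> well defined; the
  length bound drives the length reduction.
\<close>

lemma reduce_word:
  fixes K :: "('c, 'd) monoid_scheme"
  assumes "group K" and f: "\<And>i. i \<in> {1..n} \<Longrightarrow> f i \<in> hom (G\<lparr>carrier := H i\<rparr>) K"
    and "w \<in> words"
  shows "\<exists>v\<in>RW. length v \<le> length w \<and> ev v = ev w \<and>
    list_prod K (map (\<lambda>(i, x). f i x) v) = list_prod K (map (\<lambda>(i, x). f i x) w)"
  using \<open>w \<in> words\<close>
proof (induction w)
  case Nil
  then show ?case by (intro bexI[of _ "[]"]) auto
next
  case (Cons s w)
  interpret K: group K by fact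
  define F where "F = (\<lambda>v. list_prod K (map (\<lambda>(i, x). f i x) v))"
  have F_Cons: "F ((i, x) # v) = f i x \<otimes>\<^bsub>K\<^esub> F v" for i x v by (simp add: F_def)
  have f_closed: "f i x \<in> carrier K" if "i \<in> {1..n}" "x \<in> H i" for i x
    using f[OF that(1)] that(2) by (auto simp: hom_def)
  have f_mult: "f i (x \<otimes> y) = f i x \<otimes>\<^bsub>K\<^esub> f i y" if "i \<in> {1..n}" "x \<in> H i" "y \<in> H i" for i x y
    using f[OF that(1)] that(2,3) by (auto simp: hom_def)
  have f_one: "f i \<one> = \<one>\<^bsub>K\<^esub>" if "i \<in> {1..n}" for i
    using f_mult[OF that, of \<one> \<one>] f_closed[OF that, of \<one>] that by simp
  have F_closed: "F v \<in> carrier K" if "v \<in> words" for v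
    using that by (induction v) (auto simp: F_def f_closed)
  obtain i g where s: "s = (i, g)" by (cases s)
  obtain v where v: "v \<in> RW" "length v \<le> length w" "ev v = ev w" "F v = F w"
    using Cons F_def s by auto
  have ig: "i \<in> {1..n}" "g \<in> H i" "w \<in> words" using Cons.prems s by auto
  note vw = reduced_imp_word[OF v(1)]
  consider "g = \<one>" | "g \<noteq> \<one>" "v = [] \<or> fst (hd v) \<noteq> i"
    | k v' where "g \<noteq> \<one>" "v = (i, k) # v'"
    by (metis list.exhaust_sel prod.collapse)
  then have "\<exists>u\<in>RW. length u \<le> length (s # w) \<and> ev u = ev (s # w) \<and> F u = F (s # w)"
  proof cases
    case 1
    then show ?thesis
      using v ig by (intro bexI[of _ v]) (auto simp: s F_Cons f_one F_closed)
  next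
    case 2
    then show ?thesis
      using v ig by (intro bexI[of _ "s # v"]) (auto simp: s F_Cons reduced_words_Cons)
  next
    case 3
    then have k: "k \<in> H i" "v' \<in> RW" "v' = [] \<or> fst (hd v') \<noteq> i"
      using v(1) by (auto simp: reduced_words_Cons)
    note v'w = reduced_imp_word[OF k(2)]
    have len: "Suc (length v') \<le> length w" using v(2) 3 by simp
    have e: "ev (s # w) = g \<otimes> k \<otimes> ev v'"
      using v(3)[symmetric] 3 k ig v'w by (simp add: s m_assoc)
    have Fe: "F (s # w) = f i (g \<otimes> k) \<otimes>\<^bsub>K\<^esub> F v'"
      using v(4)[symmetric] 3 k ig v'w by (simp add: s F_Cons f_mult f_closed F_closed K.m_assoc)
    show ?thesis
    proof (cases "g \<otimes> k = \<one>")
      case True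
      then show ?thesis
        using e Fe len k ig v'w by (intro bexI[of _ v']) (auto simp: f_one F_closed)
    next
      case False
      then show ?thesis
        using e Fe len k ig v'w
        by (intro bexI[of _ "(i, g \<otimes> k) # v'"]) (auto simp: F_Cons reduced_words_Cons)
    qed
  qed
  then show ?case by (simp add: F_def)
qed

text \<open>
  Evaluating the \<open>f i\<close> along the reduced form of an element is multiplicative because
  \<open>reduce_word\<close> allows the concatenation of two reduced words in place of the
  reduced form of the product.
\<close>

theorem extend_hom:
  fixes K :: "('c, 'd) monoid_scheme"
  assumes "group K" and f: "\<And>i. i \<in> {1..n} \<Longrightarrow> f i \<in> hom (G\<lparr>carrier := H i\<rparr>) K"
  shows "\<exists>\<phi>\<in>hom G K. \<forall>i\<in>{1..n}. \<forall>x\<in>H i. \<phi> x = f i x"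
proof -
  interpret K: group K by fact
  define F where "F = (\<lambda>v. list_prod K (map (\<lambda>(i, x). f i x) v))"
  define \<phi> where "\<phi> = (\<lambda>g. F (SOME w. w \<in> RW \<and> ev w = g))"
  have f_closed: "f i x \<in> carrier K" if "i \<in> {1..n}" "x \<in> H i" for i x
    using f[OF that(1)] that(2) by (auto simp: hom_def)
  have F_set: "set (map (\<lambda>(i, x). f i x) v) \<subseteq> carrier K" if "v \<in> words" for v
    using that f_closed by (auto simp: words_def)
  have \<phi>_ev: "\<phi> (ev w) = F w" if w: "w \<in> words" for w
  proof -
    obtain v where v: "v \<in> RW" "ev v = ev w" "F v = F w"
      using reduce_word[OF assms w] by (auto simp: F_def)
    have "(SOME u. u \<in> RW \<and> ev u = ev w) = v"
      by (rule some_equality) (use v ev_inj in auto)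
    then show ?thesis using v by (simp add: \<phi>_def)
  qed
  have "\<phi> \<in> hom G K"
  proof (rule homI)
    fix g assume "g \<in> carrier G"
    then obtain v where v: "v \<in> words" "ev v = g" using ev_surj reduced_imp_word by blast
    then show "\<phi> g \<in> carrier K" using \<phi>_ev[of v] F_set[of v] by (simp add: F_def)
    fix h assume "h \<in> carrier G"
    then obtain w where w: "w \<in> words" "ev w = h" using ev_surj reduced_imp_word by blast
    have "F (v @ w) = F v \<otimes>\<^bsub>K\<^esub> F w"
      using K.list_prod_append[OF F_set[OF v(1)] F_set[OF w(1)]] by (simp add: F_def)
    then have "\<phi> (ev (v @ w)) = \<phi> (ev v) \<otimes>\<^bsub>K\<^esub> \<phi> (ev w)"
      using v(1) w(1) by (simp only: \<phi>_ev words_append simp_thms)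
    then show "\<phi> (g \<otimes> h) = \<phi> g \<otimes>\<^bsub>K\<^esub> \<phi> h" using v w by simp
  qed
  moreover have "\<phi> x = f i x" if "i \<in> {1..n}" "x \<in> H i" for i x
    using \<phi>_ev[of "[(i, x)]"] that f_closed[OF that] by (simp add: F_def)
  ultimately show ?thesis by blast
qed

lemma hom_eq_on_factors:
  assumes "group K" "\<phi> \<in> hom G K" "\<phi>' \<in> hom G K"
    and eq: "\<And>i x. i \<in> {1..n} \<Longrightarrow> x \<in> H i \<Longrightarrow> \<phi> x = \<phi>' x" and "g \<in> carrier G"
  shows "\<phi> g = \<phi>' g"
proof -
  obtain w where w: "w \<in> words" "ev w = g" using ev_surj reduced_imp_word assms by blast
  have "map \<phi> (map snd w) = map \<phi>' (map snd w)" using w eq by (auto simp: words_def)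
  then show ?thesis
    using w assms(1-3) hom_list_prod[OF _ _ set_snd_word[OF w(1)]] by (metis ev_def)
qed

section \<open>Whitehead automorphisms\<close>

text \<open>
  The automorphism is produced together with an inverse of the same kind, so that a Whitehead
  factor can be moved to the other side of an equation.
\<close>

lemma whitehead_exists:
  assumes "i \<in> {1..n}" "x \<in> H i" "Y \<subseteq> H ` {1..n} - {H i}"
  shows "\<exists>\<omega> \<omega>'. is_whitehead_aut G n H i Y x \<omega> \<and> is_whitehead_aut G n H i Y (inv x) \<omega>' \<and>
    \<omega> \<otimes>\<^bsub>AutoGroup G\<^esub> \<omega>' = \<one>\<^bsub>AutoGroup G\<^esub>"
proof -
  define f where "f = (\<lambda>y j g. if H j \<in> Y then inv y \<otimes> g \<otimes> y else g)"
  have ex: "\<exists>\<phi>\<in>hom G G. \<forall>j\<in>{1..n}. \<forall>g\<in>H j. \<phi> g = f y j g" if "y \<in> carrier G" for y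
  proof (rule extend_hom)
    show "f y j \<in> hom (G\<lparr>carrier := H j\<rparr>) G" if "j \<in> {1..n}" for j
      using conj_aut_hom[OF \<open>y \<in> carrier G\<close>] that by (auto simp: f_def hom_def)
  qed (rule group_axioms)
  have inverse: "\<phi>' (\<phi> g) = g"
    if y: "y \<in> H i" "y' = inv y"
      and \<phi>: "\<phi> \<in> hom G G" "\<forall>j\<in>{1..n}. \<forall>g\<in>H j. \<phi> g = f y j g"
      and \<phi>': "\<phi>' \<in> hom G G" "\<forall>j\<in>{1..n}. \<forall>g\<in>H j. \<phi>' g = f y' j g"
      and g: "g \<in> carrier G" for y y' \<phi> \<phi>' g
  proof -
    interpret \<phi>': group_hom G G \<phi>'
      using \<phi>' by (simp add: group_hom_def group_hom_axioms_def group_axioms)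
    have yc: "y \<in> carrier G" using y assms by auto
    (* Both maps fix the operating factor pointwise, so the conjugator itself does not move. *)
    have fix_y: "\<phi>' y = y" using \<phi>' y assms by (auto simp: f_def)
    have "(\<phi>' \<circ> \<phi>) g = id g"
    proof (rule hom_eq_on_factors[OF group_axioms _ _ _ g])
      show "\<phi>' \<circ> \<phi> \<in> hom G G" by (rule Group.hom_compose[OF \<phi>(1) \<phi>'(1)])
      show "id \<in> hom G G" by (auto simp: hom_def)
      fix j h assume j: "j \<in> {1..n}" "h \<in> H j"
      then have hc: "h \<in> carrier G" by auto
      show "(\<phi>' \<circ> \<phi>) h = id h"
      proof (cases "H j \<in> Y")
        case True
        then have "\<phi> h = inv y \<otimes> h \<otimes> y" "\<phi>' h = y \<otimes> h \<otimes> inv y"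
          using \<phi>(2) \<phi>'(2) j y yc by (auto simp: f_def)
        then show ?thesis
          using yc hc fix_y by (simp add: m_assoc mult_inv_cancel)
      qed (use \<phi>(2) \<phi>'(2) j in \<open>auto simp: f_def\<close>)
    qed
    then show ?thesis by simp
  qed
  have xc: "x \<in> carrier G" "inv x \<in> H i" using assms by auto
  obtain \<phi> where \<phi>: "\<phi> \<in> hom G G" "\<forall>j\<in>{1..n}. \<forall>g\<in>H j. \<phi> g = f x j g"
    using ex[OF xc(1)] by blast
  obtain \<phi>' where \<phi>': "\<phi>' \<in> hom G G" "\<forall>j\<in>{1..n}. \<forall>g\<in>H j. \<phi>' g = f (inv x) j g"
    using ex[of "inv x"] xc by auto
  have inv1: "\<phi>' (\<phi> g) = g" if "g \<in> carrier G" for g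
    by (rule inverse[OF assms(2) refl \<phi> \<phi>' that])
  have inv2: "\<phi> (\<phi>' g) = g" if "g \<in> carrier G" for g
    by (rule inverse[OF xc(2) _ \<phi>' \<phi> that]) (use xc in auto)
  let ?\<omega> = "restrict \<phi> (carrier G)" and ?\<omega>' = "restrict \<phi>' (carrier G)"
  have auts: "?\<omega> \<in> auto G" "?\<omega>' \<in> auto G"
    using autoI[OF \<phi>(1) \<phi>'(1) inv1 inv2] autoI[OF \<phi>'(1) \<phi>(1) inv2 inv1] by auto
  have "is_whitehead_aut G n H i Y x ?\<omega>" "is_whitehead_aut G n H i Y (inv x) ?\<omega>'"
    using assms auts \<phi>(2) \<phi>'(2) xc by (auto simp: is_whitehead_aut_def f_def)
  moreover have "?\<omega> \<otimes>\<^bsub>AutoGroup G\<^esub> ?\<omega>' = \<one>\<^bsub>AutoGroup G\<^esub>"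
    using auts inv2 \<phi>'(1) by (auto simp: AutoGroup_mult AutoGroup_one compose_def fun_eq_iff hom_def)
  ultimately show ?thesis by blast
qed

lemma whitehead_image:
  assumes "is_whitehead_aut G n H i Y x \<omega>" "j \<in> {1..n}"
  shows "\<omega> ` H j = (if H j \<in> Y then conj_set G (H j) x else H j)"
proof -
  have "\<omega> ` H j = (\<lambda>g. if H j \<in> Y then inv x \<otimes> g \<otimes> x else g) ` H j"
    using assms by (intro image_cong) (auto simp: is_whitehead_aut_def)
  moreover have "x \<in> carrier G" using assms by (auto simp: is_whitehead_aut_def)
  ultimately show ?thesis using factor_subset[OF assms(2)] by (simp add: conj_set_eq_image)
qed

lemma whitehead_pure_symmetric:
  assumes "is_whitehead_aut G n H i Y x \<omega>"
  shows "\<omega> \<in> pure_symmetric_auts G n H"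
proof -
  have "x \<in> carrier G" "\<omega> \<in> auto G" using assms by (auto simp: is_whitehead_aut_def)
  then show ?thesis
    using whitehead_image[OF assms] conj_set_one[OF factor_subset]
    by (auto simp: pure_symmetric_auts_def intro: bexI[of _ x] bexI[of _ \<one>])
qed

section \<open>Families of conjugators without cancellation\<close>

text \<open>
  The heart of the cancellation argument: \<open>h (a b\<^sup>-\<^sup>1) k\<close> with \<open>h \<in> H i\<close>, \<open>k \<in> H j\<close> keeps both
  outer syllables. Strip the longest common suffix of \<open>a\<close> and \<open>b\<close>. If something of both words
  is left, the last syllables differ, so they can merge only to a nontrivial syllable,
  which lies outside \<open>H i\<close> (resp. \<open>H j\<close>) when it becomes the first (resp. last) one, by the
  condition on the first syllables of \<open>a\<close> and \<open>b\<close>. If \<open>a\<close> is used up, what is left of \<open>b\<close>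
  must not end in \<open>H i\<close>, and this is what the hypothesis on \<open>b\<close> excludes; the case of \<open>b\<close> is
  symmetric.
\<close>

lemma reduced_quotient:
  assumes "a \<in> RW" "b \<in> RW" "i \<noteq> j"
    and "a = [] \<or> fst (hd a) \<noteq> i" "b = [] \<or> fst (hd b) \<noteq> j"
    and "\<And>u y. b \<noteq> u @ (i, y) # a" "\<And>u y. a \<noteq> u @ (j, y) # b"
  shows "\<exists>m\<in>RW. ev m = ev a \<otimes> inv (ev b) \<and> (m = [] \<or> fst (hd m) \<noteq> i \<and> fst (last m) \<noteq> j)"
  using assms
proof (induction a arbitrary: b rule: rev_induct)
  case Nil
  note bw = reduced_imp_word[OF Nil.prems(2)]
  have "b = [] \<or> fst (last b) \<noteq> i"
    using Nil.prems(6)[of "butlast b" "snd (last b)"] by (cases b rule: rev_cases) auto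
  then show ?case
    using Nil.prems bw by (intro bexI[of _ "winv b"]) (auto simp: winv_reduced hd_winv last_winv)
next
  case (snoc s a)
  obtain k p where s: "s = (k, p)" by (cases s)
  have a: "a \<in> RW" "k \<in> {1..n}" "p \<in> H k" "a = [] \<or> fst (last a) \<noteq> k"
    using snoc.prems(1) by (auto simp: s reduced_words_append reduced_words_Cons)
  note aw = reduced_imp_word[OF a(1)]
  note asw = reduced_imp_word[OF snoc.prems(1)]
  note bw = reduced_imp_word[OF snoc.prems(2)]
  show ?case
  proof (cases b rule: rev_cases)
    case Nil
    have "fst s \<noteq> j" using snoc.prems(7)[of a p] Nil s by auto
    then show ?thesis
      using snoc.prems asw Nil by (intro bexI[of _ "a @ [s]"]) auto
  next
    case (snoc b' t)
    note b_eq = this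
    obtain l q where t: "t = (l, q)" by (cases t)
    have b: "b' \<in> RW" "l \<in> {1..n}" "q \<in> H l" "b' = [] \<or> fst (last b') \<noteq> l"
      using snoc.prems(2) by (auto simp: b_eq t reduced_words_append reduced_words_Cons)
    note b'w = reduced_imp_word[OF b(1)]
    have hd_a: "a = [] \<and> k \<noteq> i \<or> a \<noteq> [] \<and> fst (hd a) \<noteq> i"
      using snoc.prems(4) s by (cases a) auto
    have hd_b: "b' = [] \<and> l \<noteq> j \<or> b' \<noteq> [] \<and> fst (hd b') \<noteq> j"
      using snoc.prems(5) t b_eq by (cases b') auto
    have quot: "ev (a @ [s]) \<otimes> inv (ev b) = ev a \<otimes> (p \<otimes> inv q) \<otimes> inv (ev b')"
      using a b aw b'w by (simp add: s t b_eq inv_mult_group m_assoc)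
    show ?thesis
    proof (cases "k = l")
      case False
      have "(a @ [s]) @ winv b \<in> RW"
        using snoc.prems(1) winv_reduced[OF snoc.prems(2)] False b_eq
        by (subst reduced_words_append) (auto simp: s t)
      moreover have "fst (last ((a @ [s]) @ winv b)) \<noteq> j"
        using snoc.prems(5) b_eq by (simp add: last_winv)
      moreover have "fst (hd ((a @ [s]) @ winv b)) \<noteq> i"
        using snoc.prems(4) by (cases a) auto
      ultimately show ?thesis
        using asw bw by (intro bexI[of _ "(a @ [s]) @ winv b"]) (auto simp del: append_assoc)
    next
      case kl: True
      show ?thesis
      proof (cases "p = q")
        case True
        have "\<exists>m\<in>RW. ev m = ev a \<otimes> inv (ev b') \<and>
          (m = [] \<or> fst (hd m) \<noteq> i \<and> fst (last m) \<noteq> j)"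
        proof (rule snoc.IH[OF a(1) b(1) \<open>i \<noteq> j\<close>])
          show "b' \<noteq> u @ (i, y) # a" for u y
            using snoc.prems(6)[of u y] True kl by (auto simp: s t b_eq)
          show "a \<noteq> u @ (j, y) # b'" for u y
            using snoc.prems(7)[of u y] True kl by (auto simp: s t b_eq)
        qed (use hd_a hd_b in auto)
        moreover have "p \<otimes> inv q = \<one>" using True a by simp
        ultimately show ?thesis using quot aw by simp
      next
        case False
        have "p \<otimes> inv q \<noteq> \<one>"
        proof
          assume "p \<otimes> inv q = \<one>"
          then have "inv (inv q) = p" using a b kl by (intro inv_equality) auto
          then show False using False b by simp
        qed
        moreover have "p \<otimes> inv q \<in> H k" using a b kl by simp
        ultimately have "a @ (k, p \<otimes> inv q) # winv b' \<in> RW"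
          using a b kl by (auto simp: reduced_words_append reduced_words_Cons winv_reduced hd_winv)
        moreover have "fst (hd (a @ (k, p \<otimes> inv q) # winv b')) \<noteq> i" using hd_a by auto
        moreover have "fst (last (a @ (k, p \<otimes> inv q) # winv b')) \<noteq> j"
          using hd_b kl by (auto simp: last_winv)
        moreover have "ev (a @ (k, p \<otimes> inv q) # winv b') = ev (a @ [s]) \<otimes> inv (ev b)"
          unfolding quot using a b kl aw b'w by (simp add: m_assoc)
        ultimately show ?thesis by blast
      qed
    qed
  qed
qed

text \<open>
  The families of conjugators to which no length-reducing move applies. The two parts
  correspond to dropping a syllable and to a Whitehead automorphism.
\<close>

definition irreducible_family :: "(nat \<Rightarrow> (nat \<times> 'a) list) \<Rightarrow> bool"
  where "irreducible_family w \<longleftrightarrow>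
    (\<forall>i\<in>{1..n}. w i \<in> RW \<and> (w i = [] \<or> fst (hd (w i)) \<noteq> i)) \<and>
    (\<forall>i\<in>{1..n}. \<forall>j\<in>{1..n}. i \<noteq> j \<longrightarrow> (\<forall>u y. w j \<noteq> u @ (i, y) # w i))"

text \<open>
  The syllables of \<open>v\<close> all survive, but only the start of the reduced form matters later, so the
  rest is hidden in \<open>r\<close>. The induction prepends a syllable: between it and
  the next one stands \<open>(w i) (w j)\<^sup>-\<^sup>1\<close>, to which \<open>reduced_quotient\<close> applies.
\<close>

lemma reduced_form_of_conjugates:
  assumes w: "irreducible_family w"
    and "v \<in> RW" "v \<noteq> []"
  shows "\<exists>r. winv (w (fst (hd v))) @ hd v # r \<in> RW \<and>
    ev (winv (w (fst (hd v))) @ hd v # r) =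
      list_prod G (map (\<lambda>(i, h). inv (ev (w i)) \<otimes> h \<otimes> ev (w i)) v)"
  using assms(2,3)
proof (induction v)
  case (Cons s v)
  obtain i h where s: "s = (i, h)" by (cases s)
  have i: "i \<in> {1..n}" "h \<in> H i" "h \<noteq> \<one>" "v \<in> RW" "v = [] \<or> fst (hd v) \<noteq> i"
    using Cons.prems by (auto simp: s reduced_words_Cons)
  have wi: "w i \<in> RW" "w i = [] \<or> fst (hd (w i)) \<noteq> i"
    using w i(1) by (auto simp: irreducible_family_def)
  note wiw = reduced_imp_word[OF wi(1)]
  have start: "winv (w i) = [] \<or> fst (last (winv (w i))) \<noteq> i"
    using wi(2) by (auto simp: last_winv)
  show ?case
  proof (cases v)
    case Nil
    have "winv (w i) @ (i, h) # w i \<in> RW"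
      using i wi start by (auto simp: reduced_words_append reduced_words_Cons winv_reduced)
    moreover have "ev (winv (w i) @ (i, h) # w i) = inv (ev (w i)) \<otimes> h \<otimes> ev (w i)"
      using i wiw by (simp add: m_assoc)
    ultimately show ?thesis
      using Nil i wiw by (auto simp: s)
  next
    case (Cons t v')
    obtain j k where t: "t = (j, k)" by (cases t)
    have j: "j \<in> {1..n}" "k \<in> H j" "i \<noteq> j"
      using i(4,5) by (auto simp: Cons t reduced_words_Cons)
    have wj: "w j \<in> RW" "w j = [] \<or> fst (hd (w j)) \<noteq> j"
      using w j(1) by (auto simp: irreducible_family_def)
    note wjw = reduced_imp_word[OF wj(1)]
    define P where "P = list_prod G (map (\<lambda>(i, h). inv (ev (w i)) \<otimes> h \<otimes> ev (w i)) v)"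
    obtain r where r: "winv (w j) @ (j, k) # r \<in> RW" "ev (winv (w j) @ (j, k) # r) = P"
      using Cons.IH i(4) by (auto simp: Cons t P_def)
    have r': "(j, k) # r \<in> RW" "r \<in> words"
      using r(1) reduced_imp_word by (auto simp: reduced_words_append reduced_words_Cons)
    obtain m where m: "m \<in> RW" "ev m = ev (w i) \<otimes> inv (ev (w j))"
      "m = [] \<or> fst (hd m) \<noteq> i \<and> fst (last m) \<noteq> j"
      using reduced_quotient[OF wi(1) wj(1) j(3) wi(2) wj(2)] w i(1) j(1,3)
      unfolding irreducible_family_def by metis
    note mw = reduced_imp_word[OF m(1)]
    have "m @ (j, k) # r \<in> RW"
      using m r' by (auto simp: reduced_words_append)
    then have "(i, h) # m @ (j, k) # r \<in> RW"
      using i j m(3) by (cases m) (auto simp: reduced_words_Cons)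
    then have "winv (w i) @ (i, h) # m @ (j, k) # r \<in> RW"
      using start wi by (auto simp: reduced_words_append[of "winv (w i)"] winv_reduced)
    moreover have "ev (winv (w i) @ (i, h) # m @ (j, k) # r) =
      inv (ev (w i)) \<otimes> h \<otimes> ev (w i) \<otimes> P"
      using i j wiw wjw mw m(2) r' by (simp add: r(2)[symmetric] m_assoc)
    ultimately show ?thesis by (auto simp: s P_def)
  qed
qed simp

end

locale nontrivial_free_product = free_product +
  assumes nontrivial: "\<forall>i\<in>{1..n}. H i \<noteq> {\<one>}"
begin

lemma nontrivial_element:
  assumes "i \<in> {1..n}"
  obtains h where "h \<in> H i" "h \<noteq> \<one>"
proof -
  have "H i \<noteq> {\<one>}" "\<one> \<in> H i" using assms nontrivial by auto
  then show ?thesis using that by blast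
qed

text \<open>
  Whitehead automorphisms are indexed by sets of factors rather than of indices, so moving a
  single factor requires distinct indices to have distinct factors.
\<close>

lemma factor_inj:
  assumes "i \<in> {1..n}" "j \<in> {1..n}" "H i = H j"
  shows "i = j"
proof -
  obtain h where h: "h \<in> H i" "h \<noteq> \<one>" using nontrivial_element[OF assms(1)] .
  have "[(i, h)] = [(j, h)]"
    by (rule ev_inj) (use h assms in \<open>auto simp: reduced_words_Cons\<close>)
  then show ?thesis by simp
qed

text \<open>
  Write a nontrivial \<open>h \<in> H i\<close> as \<open>\<psi> g\<close>. Pushing \<open>\<psi>\<close> through the reduced form of \<open>g\<close> gives a
  product of conjugates whose reduced form begins with \<open>(w j)\<^sup>-\<^sup>1\<close> and a syllable from \<open>H j\<close>, for
  some \<open>j\<close>. But that reduced form is the one-letter word \<open>h\<close>, so \<open>w j\<close> is empty and \<open>j = i\<close>.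
\<close>

lemma irreducible_conjugators_trivial:
  assumes \<psi>: "\<psi> \<in> auto G" and w: "irreducible_family w"
    and conj: "\<And>i. i \<in> {1..n} \<Longrightarrow> \<psi> ` H i = conj_set G (H i) (ev (w i))"
    and i: "i \<in> {1..n}"
  shows "w i = []"
proof -
  interpret \<psi>: group_hom G G \<psi>
    using autoD(1)[OF \<psi>] by (simp add: group_hom_def group_hom_axioms_def group_axioms)
  (* \<tau> j is \<psi> on H j followed by the conjugation that brings the image back to H j. *)
  define \<tau> where "\<tau> = (\<lambda>j x. ev (w j) \<otimes> \<psi> x \<otimes> inv (ev (w j)))"
  have ww: "w j \<in> words" if "j \<in> {1..n}" for j
    using w that reduced_imp_word by (auto simp: irreducible_family_def)
  have \<tau>: "\<tau> j x \<in> H j" "inv (ev (w j)) \<otimes> \<tau> j x \<otimes> ev (w j) = \<psi> x"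
    if "j \<in> {1..n}" "x \<in> H j" for j x
  proof -
    have "\<psi> x \<in> (\<lambda>k. inv (ev (w j)) \<otimes> k \<otimes> ev (w j)) ` H j"
      using conj[OF that(1)] that ww[OF that(1)] factor_subset[OF that(1)]
      by (auto simp: conj_set_eq_image)
    then obtain k where k: "k \<in> H j" "\<psi> x = inv (ev (w j)) \<otimes> k \<otimes> ev (w j)" by auto
    then have "\<tau> j x = k"
      using ww[OF that(1)] that(1) by (simp add: \<tau>_def m_assoc mult_inv_cancel)
    with k show "\<tau> j x \<in> H j" "inv (ev (w j)) \<otimes> \<tau> j x \<otimes> ev (w j) = \<psi> x" by auto
  qed
  have \<tau>_one: "\<tau> j x \<noteq> \<one>" if "j \<in> {1..n}" "x \<in> H j" "x \<noteq> \<one>" for j x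
  proof
    assume "\<tau> j x = \<one>"
    then have "\<psi> x = inv (ev (w j)) \<otimes> \<one> \<otimes> ev (w j)" using \<tau>(2)[OF that(1,2)] by simp
    then have "\<psi> x = \<psi> \<one>" using ww[OF that(1)] by simp
    then show False using autoD(2)[OF \<psi>] that by (auto simp: inj_on_def)
  qed
  obtain h where h: "h \<in> H i" "h \<noteq> \<one>" using nontrivial_element[OF i] .
  then obtain g where g: "g \<in> carrier G" "\<psi> g = h" using autoD(3)[OF \<psi>] i by (metis factor_closed(1) imageE)
  obtain v where v: "v \<in> RW" "ev v = g" using ev_surj g by blast
  define v' where "v' = map (\<lambda>(j, x). (j, \<tau> j x)) v"
  have fst_v': "map fst v' = map fst v" by (simp add: v'_def case_prod_beta)
  have v': "v' \<in> RW"
  proof -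
    have "j \<in> {1..n} \<and> y \<in> H j \<and> y \<noteq> \<one>" if y: "(j, y) \<in> set v'" for j y
    proof -
      obtain x where x: "(j, x) \<in> set v" "y = \<tau> j x" using y by (auto simp: v'_def)
      then have "j \<in> {1..n}" "x \<in> H j" "x \<noteq> \<one>" using v(1) by (auto simp: reduced_words_def)
      then show ?thesis using x(2) \<tau>(1)[of j x] \<tau>_one[of j x] by simp
    qed
    then show ?thesis using v(1) unfolding reduced_words_def mem_Collect_eq fst_v' by auto
  qed
  have "v \<noteq> []" using v g h by auto
  then have v'_ne: "v' \<noteq> []" by (simp add: v'_def)
  have "\<psi> (ev v) = list_prod G (map \<psi> (map snd v))"
    unfolding ev_def
    by (rule hom_list_prod[OF group_axioms autoD(1)[OF \<psi>] set_snd_word[OF reduced_imp_word[OF v(1)]]])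
  then have "h = list_prod G (map \<psi> (map snd v))" unfolding v(2) g(2) .
  also have "map \<psi> (map snd v) = map (\<lambda>(i, h). inv (ev (w i)) \<otimes> h \<otimes> ev (w i)) v'"
    using reduced_imp_word[OF v(1)] \<tau>(2) by (auto simp: v'_def words_def)
  finally obtain r where r: "winv (w (fst (hd v'))) @ hd v' # r \<in> RW"
      "ev (winv (w (fst (hd v'))) @ hd v' # r) = h"
    using reduced_form_of_conjugates[OF w v' v'_ne] by auto
  have "winv (w (fst (hd v'))) @ hd v' # r = [(i, h)]"
    by (rule ev_inj) (use r h i in \<open>auto simp: reduced_words_Cons\<close>)
  then show ?thesis by (auto simp: append_eq_Cons_conv)
qed

section \<open>Length reduction\<close>

lemma factor_autI:
  assumes "\<psi> \<in> auto G" and im: "\<And>i. i \<in> {1..n} \<Longrightarrow> \<psi> ` H i = H i"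
  shows "\<psi> \<in> factor_auts G n H"
proof -
  have "restrict \<psi> (H i) \<in> auto (G\<lparr>carrier := H i\<rparr>)" if i: "i \<in> {1..n}" for i
  proof -
    have "inj_on \<psi> (H i)"
      using autoD(2)[OF assms(1)] factor_subset[OF i] by (rule inj_on_subset)
    then have "bij_betw (restrict \<psi> (H i)) (H i) (H i)"
      using im[OF i] by (simp add: bij_betw_def inj_on_def)
    moreover have "\<psi> x \<in> H i" if "x \<in> H i" for x using im[OF i] that by blast
    ultimately show ?thesis
      using autoD(1)[OF assms(1)] i by (auto simp: auto_def Bij_def hom_def)
  qed
  moreover have "\<psi> \<in> pure_symmetric_auts G n H"
    using assms(1) im conj_set_one[OF factor_subset]
    by (auto simp: pure_symmetric_auts_def intro!: bexI[of _ \<one>])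
  ultimately show ?thesis by (simp add: factor_auts_def)
qed

definition whitehead_auts :: "('a \<Rightarrow> 'a) set"
  where "whitehead_auts = {\<omega>. \<exists>i Y x. is_whitehead_aut G n H i Y x \<omega>}"

text \<open>
  Induction on the total length of an arbitrary choice of conjugating words. Leaving the choice
  free lets the move that drops a syllable change the words alone, without touching \<open>\<psi>\<close>.
\<close>

theorem pure_symmetric_aut_decomposition:
  assumes "\<psi> \<in> auto G"
    and "\<forall>i\<in>{1..n}. w i \<in> RW \<and> \<psi> ` H i = conj_set G (H i) (ev (w i))"
  shows "\<exists>\<alpha>s. set \<alpha>s \<subseteq> factor_auts G n H \<union> whitehead_auts \<and> \<psi> = list_prod (AutoGroup G) \<alpha>s"
  using assms
proof (induction "\<Sum>i=1..n. length (w i)" arbitrary: \<psi> w rule: less_induct)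
  case less
  interpret A: group "AutoGroup G" by (rule AutoGroup)
  note \<psi> = less.prems(1)
  interpret \<psi>: group_hom G G \<psi>
    using autoD(1)[OF \<psi>] by (simp add: group_hom_def group_hom_axioms_def group_axioms)
  have w: "w i \<in> RW" "w i \<in> words" "\<psi> ` H i = conj_set G (H i) (ev (w i))" if "i \<in> {1..n}" for i
    using less.prems(2) that reduced_imp_word by auto
  have shorter: "(\<Sum>i=1..n. length ((w(j := v)) i)) < (\<Sum>i=1..n. length (w i))"
    if "j \<in> {1..n}" "length v < length (w j)" for j v
    using that by (intro sum_strict_mono_ex1) auto
  consider
      (cancel) j y u where "j \<in> {1..n}" "w j = (j, y) # u"
    | (whitehead) i j u y where "i \<in> {1..n}" "j \<in> {1..n}" "i \<noteq> j" "w j = u @ (i, y) # w i"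
    | (irreducible) "irreducible_family w"
  proof (cases "irreducible_family w")
    case False
    then consider j where "j \<in> {1..n}" "w j \<noteq> []" "fst (hd (w j)) = j"
      | i j u y where "i \<in> {1..n}" "j \<in> {1..n}" "i \<noteq> j" "w j = u @ (i, y) # w i"
      using w(1) unfolding irreducible_family_def by blast
    then show ?thesis
    proof cases
      case (1 j)
      then have "w j = (j, snd (hd (w j))) # tl (w j)" by (metis list.exhaust_sel prod.collapse)
      then show ?thesis using cancel 1(1) by blast
    qed (use whitehead in blast)
  qed (rule irreducible)
  then show ?case
  proof cases
    case cancel
    have y: "y \<in> H j" "u \<in> RW" using w(1)[OF cancel(1)] cancel by (auto simp: reduced_words_Cons)
    have "conj_set G (H j) (ev (w j)) = conj_set G (conj_set G (H j) y) (ev u)"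
      using y reduced_imp_word[OF y(2)] cancel factor_subset
      by (simp add: conj_set_conj_set)
    then have "\<psi> ` H j = conj_set G (H j) (ev u)"
      using w(3)[OF cancel(1)] conj_set_self[OF subgroup_factor[OF cancel(1)] y(1)] by simp
    then have "\<forall>i\<in>{1..n}. (w(j := u)) i \<in> RW \<and> \<psi> ` H i = conj_set G (H i) (ev ((w(j := u)) i))"
      using y w by auto
    then show ?thesis
      using less.hyps[OF shorter[of j u] \<psi>] cancel by simp
  next
    case whitehead
    note i = whitehead(1) and j = whitehead(2)
    have u: "u \<in> words" "y \<in> H i"
      using w(2)[OF j] whitehead by auto
    let ?g = "ev (w i)"
    have gc: "?g \<in> carrier G" "y \<in> carrier G" using w(2)[OF i] u i by auto
    (* The conjugating element x must satisfy g_j (psi x) = u g_i, which cancels the syllable y. *)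
    have "inv ?g \<otimes> inv y \<otimes> ?g \<in> conj_set G (H i) ?g"
      using gc u i factor_subset[OF i] by (auto simp: conj_set_eq_image)
    then obtain x where x: "x \<in> H i" "\<psi> x = inv ?g \<otimes> inv y \<otimes> ?g"
      using w(3)[OF i] by (metis imageE)
    have xc: "x \<in> carrier G" using x i by auto
    have Y: "{H j} \<subseteq> H ` {1..n} - {H i}" using factor_inj i j whitehead(3) by auto
    obtain \<omega> \<omega>' where \<omega>: "is_whitehead_aut G n H i {H j} x \<omega>"
        "is_whitehead_aut G n H i {H j} (inv x) \<omega>'"
        "\<omega> \<otimes>\<^bsub>AutoGroup G\<^esub> \<omega>' = \<one>\<^bsub>AutoGroup G\<^esub>"
      using whitehead_exists[OF i x(1) Y] by blast
    have \<omega>_aut: "\<omega> \<in> auto G" "\<omega>' \<in> auto G" using \<omega> by (auto simp: is_whitehead_aut_def)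
    let ?\<psi>' = "\<psi> \<otimes>\<^bsub>AutoGroup G\<^esub> \<omega>"
    have \<psi>'_aut: "?\<psi>' \<in> auto G"
      using A.m_closed[of \<psi> \<omega>] \<psi> \<omega>_aut by (simp add: AutoGroup_carrier)
    have \<psi>'_image: "?\<psi>' ` H k = \<psi> ` \<omega> ` H k" if "k \<in> {1..n}" for k
    proof -
      have "?\<psi>' x = \<psi> (\<omega> x)" if "x \<in> H k" for x
        using \<psi> \<omega>_aut that \<open>k \<in> {1..n}\<close> by (simp add: AutoGroup_mult compose_eq)
      then show ?thesis by (simp add: image_image cong: image_cong)
    qed
    have "(\<lambda>g. g) \<in> hom (G\<lparr>carrier := H k\<rparr>) G" if "k \<in> {1..n}" for k
      using that by (auto simp: hom_def)
    moreover have "u @ w i \<in> words" using u(1) w(2)[OF i] by simp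
    ultimately obtain v where v: "v \<in> RW" "length v \<le> length (u @ w i)" "ev v = ev (u @ w i)"
      using reduce_word[OF group_axioms, of "\<lambda>_ g. g" "u @ w i"] by blast
    have "ev (w j) \<otimes> \<psi> x = ev v"
      using u w(2)[OF i] gc v(3) i unfolding x(2)
      by (simp add: whitehead(4) m_assoc mult_inv_cancel)
    moreover have "?\<psi>' ` H j = conj_set G (\<psi> ` H j) (\<psi> x)"
      using \<psi>'_image[OF j] whitehead_image[OF \<omega>(1) j] hom_image_conj_set[OF autoD(1)[OF \<psi>] factor_subset[OF j] xc]
      by simp
    ultimately have "?\<psi>' ` H j = conj_set G (H j) (ev v)"
      using w(2,3)[OF j] xc by (simp add: conj_set_conj_set[OF factor_subset[OF j]])
    moreover have "?\<psi>' ` H k = \<psi> ` H k" if "k \<in> {1..n}" "k \<noteq> j" for k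
      using \<psi>'_image[OF that(1)] whitehead_image[OF \<omega>(1) that(1)] factor_inj[OF that(1) j] that(2)
      by auto
    ultimately have "\<forall>k\<in>{1..n}. (w(j := v)) k \<in> RW \<and>
        ?\<psi>' ` H k = conj_set G (H k) (ev ((w(j := v)) k))"
      using w v by auto
    moreover have "length v < length (w j)" using v(2) whitehead(4) by simp
    ultimately obtain \<alpha>s where \<alpha>s: "set \<alpha>s \<subseteq> factor_auts G n H \<union> whitehead_auts"
        "?\<psi>' = list_prod (AutoGroup G) \<alpha>s"
      using less.hyps[OF shorter[OF j] \<psi>'_aut] by blast
    have "set \<alpha>s \<subseteq> carrier (AutoGroup G)"
      using \<alpha>s(1) by (auto simp: AutoGroup_carrier factor_auts_def pure_symmetric_auts_def
        whitehead_auts_def is_whitehead_aut_def)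
    then have "list_prod (AutoGroup G) (\<alpha>s @ [\<omega>']) = ?\<psi>' \<otimes>\<^bsub>AutoGroup G\<^esub> \<omega>'"
      using \<omega>_aut by (subst A.list_prod_append) (auto simp: AutoGroup_carrier \<alpha>s(2))
    also have "\<dots> = \<psi>"
      using \<psi> \<omega>_aut \<omega>(3) by (simp add: A.m_assoc AutoGroup_carrier)
    finally have "\<psi> = list_prod (AutoGroup G) (\<alpha>s @ [\<omega>'])" by simp
    moreover have "set (\<alpha>s @ [\<omega>']) \<subseteq> factor_auts G n H \<union> whitehead_auts"
      using \<alpha>s(1) \<omega>(2) by (auto simp: whitehead_auts_def)
    ultimately show ?thesis by blast
  next
    case irreducible
    have "\<psi> ` H i = H i" if "i \<in> {1..n}" for i
      using w(3)[OF that] irreducible_conjugators_trivial[OF \<psi> irreducible w(3) that]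
        conj_set_one[OF factor_subset[OF that]] by simp
    then have "\<psi> \<in> factor_auts G n H" by (rule factor_autI[OF \<psi>])
    then show ?thesis
      using \<psi> by (intro exI[of _ "[\<psi>]"]) (simp add: AutoGroup_carrier)
  qed
qed

end

theorem theorem5p4:
  fixes G :: "('a, 'b) monoid_scheme" and n :: nat and H :: "nat \<Rightarrow> 'a set"
    and \<Psi> :: "('a \<Rightarrow> 'a) set"
  assumes "is_free_product G n H"
    and "n \<ge> 3"
    and "\<forall>i\<in>{1..n}. H i \<noteq> {\<one>\<^bsub>G\<^esub>}"
    and "\<Psi> \<in> pure_symmetric_outs G n H"
  shows "\<exists>\<Phi>s. set \<Phi>s \<subseteq> factor_outs G n H \<union> whitehead_outs G n H \<and>
    \<Psi> = list_prod (Out G) \<Phi>s"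
proof -
  interpret nontrivial_free_product G n H
  proof (intro nontrivial_free_product.intro free_product.intro free_product_axioms.intro
      nontrivial_free_product_axioms.intro)
    show "group G" using assms(1) by (simp add: is_free_product_def)
  qed (fact assms(1) assms(3))+
  obtain \<psi> where \<psi>: "\<Psi> \<in> carrier (Out G)" "\<psi> \<in> \<Psi>" "\<psi> \<in> pure_symmetric_auts G n H"
    using assms(4) by (auto simp: pure_symmetric_outs_def)
  have "\<forall>i\<in>{1..n}. \<exists>w. w \<in> RW \<and> \<psi> ` H i = conj_set G (H i) (ev w)"
  proof
    fix i assume "i \<in> {1..n}"
    then have "\<exists>g\<in>carrier G. \<psi> ` H i = conj_set G (H i) g"
      using \<psi>(3) unfolding pure_symmetric_auts_def by blast
    then obtain g where g: "g \<in> carrier G" "\<psi> ` H i = conj_set G (H i) g" ..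
    obtain w where "w \<in> RW" "ev w = g" using ev_surj[OF g(1)] ..
    with g(2) show "\<exists>w. w \<in> RW \<and> \<psi> ` H i = conj_set G (H i) (ev w)" by auto
  qed
  from bchoice[OF this]
  obtain w where w: "\<forall>i\<in>{1..n}. w i \<in> RW \<and> \<psi> ` H i = conj_set G (H i) (ev (w i))" ..
  obtain \<alpha>s where \<alpha>s: "set \<alpha>s \<subseteq> factor_auts G n H \<union> whitehead_auts"
      "\<psi> = list_prod (AutoGroup G) \<alpha>s"
    using pure_symmetric_aut_decomposition[OF outer_class_rep(1)[OF \<psi>(1,2)] w] by blast
  have sym: "\<alpha> \<in> pure_symmetric_auts G n H" "\<alpha> \<in> auto G" if "\<alpha> \<in> set \<alpha>s" for \<alpha>
    using that \<alpha>s(1) whitehead_pure_symmetric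
    by (auto simp: whitehead_auts_def factor_auts_def pure_symmetric_auts_def)
  let ?c = "\<lambda>\<alpha>. Inn G #>\<^bsub>AutoGroup G\<^esub> \<alpha>"
  have "?c \<alpha> \<in> factor_outs G n H \<union> whitehead_outs G n H" if "\<alpha> \<in> set \<alpha>s" for \<alpha>
    using that \<alpha>s(1) sym[OF that] outer_class_mem[of \<alpha>]
    unfolding factor_outs_def whitehead_outs_def pure_symmetric_outs_def whitehead_auts_def by blast
  moreover have "\<Psi> = list_prod (Out G) (map ?c \<alpha>s)"
    using outer_class_list_prod[of \<alpha>s] outer_class_rep(2)[OF \<psi>(1,2)] \<alpha>s(2) sym by auto
  ultimately show ?thesis by (intro exI[of _ "map ?c \<alpha>s"]) auto
qed

end
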